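(* Let $\gamma_-$ and $\gamma_+$ be smooth embedded loops in $\mathbb{R}^2$, each bounding a strictly convex domain. Then the symplectic billiard map of the pair $(\gamma_-,\gamma_+)$ has infinitely many periodic orbits.
   Context: Let $\gamma_-$ and $\gamma_+$ be smooth embedded loops in the plane each bounding a strictly convex domain. For $x\in\gamma_\pm$ let $\nu_x$ be the outer unit normal and $T_x\gamma_\pm\subset\mathbb{R}^2$ the (linear) tangent line. The notation $\gamma_\pm,\gamma_\mp$ indicates a choice of sign and its opposite. The phase space is $\mathcal{P}(\gamma_-,\gamma_+)=\{(x,y)\in(\gamma_-\times\gamma_+)\sqcup(\gamma_+\times\gamma_-)\mid\det(\nu_x,\nu_y)\neq0\}$. For $(x_0,x_1)\in\mathcal{P}(\gamma_-,\gamma_+)$ with $x_0\in\gamma_\pm$, $x_1\in\gamma_\mp$, let $x_2$ be the unique intersection point other than $x_0$ of $\gamma_\pm$ with the line $x_0+T_{x_1}\gamma_\mp$. The symplectic billiard map is $\phi(x_0,x_1)=(x_1,x_2)$; it maps $\mathcal{P}(\gamma_-,\gamma_+)$ into itself and is invertible there. An orbit $(\phi^k(x_0,x_1))_{k\in\mathbb{Z}}$ is periodic if $\phi^n(x_0,x_1)=(x_0,x_1)$ for some $n\ge1$. *)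

theory Defs
  imports "HOL-Analysis.Analysis"
begin

definition smooth_curve :: "(real \<Rightarrow> 'a::real_normed_vector) \<Rightarrow> bool" where
  "smooth_curve c \<longleftrightarrow>
     (\<forall>n t. ((\<lambda>f s. vector_derivative f (at s)) ^^ n) c differentiable (at t))"

text \<open>A loop is a subset of the plane; the witness \<open>c\<close> is a regular parametrization of period 1,
  injective modulo the period, i.e. an embedding of the circle.\<close>

definition smooth_embedded_loop :: "(real^2) set \<Rightarrow> bool" where
  "smooth_embedded_loop \<gamma> \<longleftrightarrow>
     (\<exists>c. smooth_curve c \<and> (\<forall>t. vector_derivative c (at t) \<noteq> 0) \<and>
          (\<forall>s t. c s = c t \<longleftrightarrow> s - t \<in> \<int>) \<and> \<gamma> = range c)"

definition strictly_convex :: "'a::real_normed_vector set \<Rightarrow> bool" where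
  "strictly_convex D \<longleftrightarrow>
     (\<forall>x\<in>closure D. \<forall>y\<in>closure D. x \<noteq> y \<longrightarrow> open_segment x y \<subseteq> interior D)"

definition bounds_domain :: "(real^2) set \<Rightarrow> (real^2) set \<Rightarrow> bool" where
  "bounds_domain \<gamma> D \<longleftrightarrow> open D \<and> connected D \<and> bounded D \<and> frontier D = \<gamma>"

text \<open>The tangent space at \<open>x\<close> as the set of velocities at \<open>x\<close> of smooth curves lying in \<open>\<gamma>\<close>.\<close>

definition tangent_line :: "(real^2) set \<Rightarrow> real^2 \<Rightarrow> (real^2) set" where
  "tangent_line \<gamma> x =
     {vector_derivative c (at 0) | c. smooth_curve c \<and> range c \<subseteq> \<gamma> \<and> c 0 = x}"

text \<open>The domain bounded by a loop \<open>\<gamma>\<close> is \<open>inside \<gamma>\<close>.\<close>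

definition outer_normal :: "(real^2) set \<Rightarrow> real^2 \<Rightarrow> real^2" where
  "outer_normal \<gamma> x =
     (THE \<nu>. norm \<nu> = 1 \<and> (\<forall>v\<in>tangent_line \<gamma> x. \<nu> \<bullet> v = 0) \<and>
             (\<exists>\<epsilon>>0. \<forall>t. 0 < t \<and> t < \<epsilon> \<longrightarrow> x + t *\<^sub>R \<nu> \<notin> inside \<gamma>))"

definition transversal :: "(real^2) set \<Rightarrow> (real^2) set \<Rightarrow> real^2 \<Rightarrow> real^2 \<Rightarrow> bool" where
  "transversal \<gamma> \<delta> x y \<longleftrightarrow> det (vector [outer_normal \<gamma> x, outer_normal \<delta> y] :: real^2^2) \<noteq> 0"

text \<open>The two loops may intersect or coincide, so the union of the two products is tagged:
  \<open>Inl\<close> for the first loop times the second, \<open>Inr\<close> for the second times the first.\<close>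

type_synonym phase_point = "(real^2) \<times> (real^2) + (real^2) \<times> (real^2)"

definition phase_space :: "(real^2) set \<Rightarrow> (real^2) set \<Rightarrow> phase_point set" where
  "phase_space \<gamma>m \<gamma>p =
     {p \<in> (\<gamma>m \<times> \<gamma>p) <+> (\<gamma>p \<times> \<gamma>m).
        case p of Inl (x, y) \<Rightarrow> transversal \<gamma>m \<gamma>p x y
                | Inr (x, y) \<Rightarrow> transversal \<gamma>p \<gamma>m x y}"

text \<open>For \<open>x0\<close> on \<open>\<gamma>\<close> and \<open>x1\<close> on \<open>\<delta>\<close>.\<close>

definition next_point :: "(real^2) set \<Rightarrow> (real^2) set \<Rightarrow> real^2 \<Rightarrow> real^2 \<Rightarrow> real^2" where
  "next_point \<gamma> \<delta> x0 x1 =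
     (THE x2. x2 \<in> \<gamma> \<and> x2 \<in> (\<lambda>v. x0 + v) ` tangent_line \<delta> x1 \<and> x2 \<noteq> x0)"

definition symplectic_billiard ::
    "(real^2) set \<Rightarrow> (real^2) set \<Rightarrow> phase_point \<Rightarrow> phase_point" where
  "symplectic_billiard \<gamma>m \<gamma>p p =
     (case p of Inl (x0, x1) \<Rightarrow> Inr (x1, next_point \<gamma>m \<gamma>p x0 x1)
              | Inr (x0, x1) \<Rightarrow> Inl (x1, next_point \<gamma>p \<gamma>m x0 x1))"

text \<open>Negative iterates use the inverse of the map on the phase space.\<close>

definition billiard_iterate ::
    "(real^2) set \<Rightarrow> (real^2) set \<Rightarrow> int \<Rightarrow> phase_point \<Rightarrow> phase_point" where
  "billiard_iterate \<gamma>m \<gamma>p k =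
     (if k \<ge> 0 then symplectic_billiard \<gamma>m \<gamma>p ^^ nat k
      else inv_into (phase_space \<gamma>m \<gamma>p) (symplectic_billiard \<gamma>m \<gamma>p) ^^ nat (- k))"

text \<open>An orbit is the set of its points, so that time shifts of one orbit are not counted as
  different orbits.\<close>

definition billiard_orbit :: "(real^2) set \<Rightarrow> (real^2) set \<Rightarrow> phase_point \<Rightarrow> phase_point set" where
  "billiard_orbit \<gamma>m \<gamma>p p = range (\<lambda>k. billiard_iterate \<gamma>m \<gamma>p k p)"

definition periodic_orbits :: "(real^2) set \<Rightarrow> (real^2) set \<Rightarrow> phase_point set set" where
  "periodic_orbits \<gamma>m \<gamma>p =
     {billiard_orbit \<gamma>m \<gamma>p p | p.
        p \<in> phase_space \<gamma>m \<gamma>p \<and> (\<exists>n\<ge>1. (symplectic_billiard \<gamma>m \<gamma>p ^^ n) p = p)}"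

end

theory Submission
  imports Defs
begin

text \<open>Configurations \<open>z\<^sub>0, \<dots>, z\<^bsub>2p-1\<^esub>\<close>, taken alternately on the two loops and read cyclically, carry
  the action \<open>det(z\<^sub>0, z\<^sub>1) + det(z\<^sub>1, z\<^sub>2) + \<dots> + det(z\<^bsub>2p-1\<^esub>, z\<^sub>0)\<close>; it is critical in \<open>z\<^sub>k\<close> iff the
  chord \<open>z\<^bsub>k+1\<^esub> - z\<^bsub>k-1\<^esub>\<close> is tangent at \<open>z\<^sub>k\<close>. The action attains its maximum on the compact set of all
  configurations. If a maximizer had \<open>z\<^bsub>k+1\<^esub> = z\<^bsub>k-1\<^esub>\<close>, the action would not depend on \<open>z\<^sub>k\<close>, so \<open>z\<^sub>k\<close>
  could be moved along its whole loop without losing maximality, and tangency at \<open>z\<^bsub>k+1\<^esub>\<close> would force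
  that loop into a line. Hence a maximizer is a genuine billiard trajectory. For \<open>p\<close> prime, the
  square of the billiard map acts on it with period \<open>p\<close> and without fixed points, so the
  orbit has at least \<open>p\<close> elements. Thus the cardinalities of periodic orbits are unbounded.\<close>

section \<open>Linear algebra of the plane\<close>

definition perp :: "real^2 \<Rightarrow> real^2" where
  "perp v = vector [v $ 2, - v $ 1]"

text \<open>This is det(a, b). Writing the area form as an inner product with a clockwise quarter
  turn turns the action into a linear functional of each single vertex.\<close>

lemma inner_perp: "a \<bullet> perp b = a $ 1 * b $ 2 - a $ 2 * b $ 1"
  by (simp add: perp_def inner_vec_def UNIV_2)

lemma vec2_nonzero: "(v::real^2) \<noteq> 0 \<longleftrightarrow> v $ 1 \<noteq> 0 \<or> v $ 2 \<noteq> 0"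
  by (simp add: vec_eq_iff forall_2)

lemma inner_vec2: "(a::real^2) \<bullet> b = a $ 1 * b $ 1 + a $ 2 * b $ 2"
  by (simp add: inner_vec_def UNIV_2)

text \<open>In the plane \<open>m\<close> is a nonzero multiple of the quarter turn of
  \<open>w\<close>, so the determinant is a nonzero multiple of \<open>n \<bullet> w\<close>. This
  translates a condition on two normals into one on a normal and a tangent vector.\<close>

lemma det_vector_eq_0_iff:
  fixes m n w :: "real^2"
  assumes "w \<noteq> 0" "m \<noteq> 0" "m \<bullet> w = 0"
  shows "det (vector [n, m] :: real^2^2) = 0 \<longleftrightarrow> n \<bullet> w = 0"
proof -
  have d: "det (vector [n, m] :: real^2^2) = n $ 1 * m $ 2 - n $ 2 * m $ 1"
    by (simp add: det_2)
  have "m $ 1 * w $ 1 + m $ 2 * w $ 2 = 0"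
    using assms(3) by (simp add: inner_vec2)
  then show ?thesis
    using assms(1,2) unfolding d inner_vec2 vec2_nonzero
    by algebra
qed

lemma parallel_if_perp_eq_0:
  assumes "a \<bullet> perp e = 0" "e \<noteq> 0"
  shows "\<exists>s. a = s *\<^sub>R e"
proof (cases "e $ 1 = 0")
  case True
  with assms show ?thesis
    by (intro exI[of _ "a $ 2 / e $ 2"]) (auto simp: inner_perp vec_eq_iff forall_2 vec2_nonzero)
next
  case False
  with assms show ?thesis
    by (intro exI[of _ "a $ 1 / e $ 1"]) (auto simp: inner_perp vec_eq_iff forall_2 field_simps)
qed

lemma parallel_if_common_normal:
  fixes a e \<nu> :: "real^2"
  assumes "\<nu> \<bullet> a = 0" "\<nu> \<bullet> e = 0" "\<nu> \<noteq> 0" "e \<noteq> 0"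
  shows "\<exists>s. a = s *\<^sub>R e"
proof (rule parallel_if_perp_eq_0)
  show "a \<bullet> perp e = 0"
    using assms(1,2,3) unfolding inner_perp vec2_nonzero unfolding inner_vec2 by algebra
qed fact

section \<open>Smooth curves under affine change of parameter\<close>

lemma iterated_derivative_affine:
  assumes "smooth_curve c"
  shows "((\<lambda>f s. vector_derivative f (at s)) ^^ n) (\<lambda>s. c (t + a * s)) =
    (\<lambda>s. a ^ n *\<^sub>R ((\<lambda>f s. vector_derivative f (at s)) ^^ n) c (t + a * s))"
proof (induction n)
  case (Suc n)
  let ?g = "((\<lambda>f s. vector_derivative f (at s)) ^^ n) c"
  have "((\<lambda>s. a ^ n *\<^sub>R ?g (t + a * s)) has_vector_derivative
      a ^ n *\<^sub>R a *\<^sub>R vector_derivative ?g (at (t + a * s))) (at s)" for s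
  proof -
    have 1: "((\<lambda>s. t + a * s) has_vector_derivative a) (at s)"
      by (auto intro!: derivative_eq_intros simp flip: has_real_derivative_iff_has_vector_derivative)
    have 2: "(?g has_vector_derivative vector_derivative ?g (at (t + a * s))) (at (t + a * s))"
      using assms unfolding smooth_curve_def by (blast intro: vector_derivative_works[THEN iffD1])
    show ?thesis
      by (rule bounded_linear.has_vector_derivative[OF bounded_linear_scaleR_right])
        (use vector_diff_chain_at[OF 1 2] in \<open>simp add: o_def\<close>)
  qed
  then show ?case
    unfolding funpow.simps o_apply Suc
    by (intro ext vector_derivative_at) (simp add: mult.commute)
qed simp

text \<open>\<open>smooth_curve\<close> asks for differentiability of every iterated derivative,
  hence the closed form above for all \<open>n\<close>, which reduces the claim to the chain
  rule.\<close>

lemma smooth_curve_affine: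
  assumes "smooth_curve c"
  shows "smooth_curve (\<lambda>s. c (t + a * s))"
  unfolding smooth_curve_def iterated_derivative_affine[OF assms]
proof (intro allI)
  fix n s
  let ?g = "((\<lambda>f s. vector_derivative f (at s)) ^^ n) c"
  have "?g differentiable (at (t + a * s))"
    using assms unfolding smooth_curve_def by blast
  then have "(?g \<circ> (\<lambda>s. t + a * s)) differentiable (at s)"
    by (intro differentiable_chain_at) (auto intro!: derivative_intros)
  then show "(\<lambda>s. a ^ n *\<^sub>R ?g (t + a * s)) differentiable (at s)"
    by (auto simp: o_def intro!: derivative_intros)
qed

lemma smooth_curve_has_vector_derivative:
  assumes "smooth_curve c"
  shows "(c has_vector_derivative vector_derivative c (at t)) (at t)"
  using assms unfolding smooth_curve_def vector_derivative_works[symmetric]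
  by (metis funpow_0)

section \<open>Supporting lines, tangent lines and normals of a strictly convex loop\<close>

lemma inner_less_if_open:
  fixes D :: "'a::real_inner set"
  assumes "open D" "z \<in> D" "\<nu> \<noteq> 0" "\<And>y. y \<in> D \<Longrightarrow> \<nu> \<bullet> y \<le> b"
  shows "\<nu> \<bullet> z < b"
proof -
  obtain r where r: "r > 0" "ball z r \<subseteq> D"
    using assms open_contains_ball by blast
  \<comment> \<open>A small step from \<open>z\<close> along \<open>\<nu>\<close> stays in
    \<open>D\<close> and strictly raises the functional, so the bound cannot be attained at
    \<open>z\<close>.\<close>
  define y where "y = z + (r / 2 / norm \<nu>) *\<^sub>R \<nu>"
  have "y \<in> ball z r"
    using r assms by (simp add: y_def dist_norm)
  then have "\<nu> \<bullet> y \<le> b"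
    using r assms by blast
  moreover have "\<nu> \<bullet> y > \<nu> \<bullet> z"
    using r assms by (simp add: y_def inner_add_right)
  ultimately show ?thesis by simp
qed

locale convex_loop =
  fixes \<gamma> :: "(real^2) set"
  assumes loop: "smooth_embedded_loop \<gamma>"
    and domain: "\<exists>D. bounds_domain \<gamma> D \<and> strictly_convex D"
begin

text \<open>The hypotheses speak of some domain \<open>D\<close>, the outer normal of
  \<open>inside \<gamma>\<close>. Strict convexity makes \<open>D\<close> convex, and a bounded open
  convex set is the inside of its frontier, so both are the same set.\<close>

lemma inside_domain:
  shows open_domain: "open (inside \<gamma>)" and bounded_domain: "bounded (inside \<gamma>)"
    and frontier_domain: "frontier (inside \<gamma>) = \<gamma>" and strictly_convex_domain: "strictly_convex (inside \<gamma>)"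
    and convex_domain: "convex (inside \<gamma>)"
proof -
  obtain D where D: "open D" "bounded D" "frontier D = \<gamma>" "strictly_convex D"
    using domain unfolding bounds_domain_def by blast
  have "convex D"
    unfolding convex_contains_open_segment
  proof (intro ballI)
    fix x y assume "x \<in> D" "y \<in> D"
    then show "open_segment x y \<subseteq> D"
      using D(1,4) closure_subset[of D] unfolding strictly_convex_def
      by (cases "x = y") (auto simp: interior_open)
  qed
  moreover from this have "inside \<gamma> = D"
    using inside_frontier_eq_interior[of D] D by (simp add: interior_open)
  ultimately show "open (inside \<gamma>)" "bounded (inside \<gamma>)" "frontier (inside \<gamma>) = \<gamma>"
    "strictly_convex (inside \<gamma>)" "convex (inside \<gamma>)"
    using D by auto
qed

lemma closure_domain: "closure (inside \<gamma>) = inside \<gamma> \<union> \<gamma>"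
  by (metis closure_Un_frontier frontier_domain)

lemma compact_loop: "compact \<gamma>"
  by (metis bounded_domain compact_frontier_bounded frontier_domain)

lemma parametrization:
  obtains c where "smooth_curve c" "\<And>t. vector_derivative c (at t) \<noteq> 0" "range c = \<gamma>"
  using loop unfolding smooth_embedded_loop_def by blast

lemma ex_other_point: "\<exists>y\<in>\<gamma>. y \<noteq> x"
proof -
  obtain c :: "real \<Rightarrow> real^2" where c: "\<forall>s t. c s = c t \<longleftrightarrow> s - t \<in> \<int>" "\<gamma> = range c"
    using loop unfolding smooth_embedded_loop_def by auto
  \<comment> \<open>The parameters 0 and 1/2 do not differ by an integer, so they give two distinct
    points of the loop.\<close>
  have "(0::real) - 1/2 \<notin> \<int>"
  proof
    assume "(0::real) - 1/2 \<in> \<int>"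
    then obtain k :: int where "(0::real) - 1/2 = of_int k" by (auto elim: Ints_cases)
    then have "2 * k = -1" by linarith
    then show False by presburger
  qed
  then show ?thesis using c by (metis rangeI)
qed

lemma nonempty: "\<gamma> \<noteq> {}"
  using ex_other_point by blast

lemma inside_nonempty: "inside \<gamma> \<noteq> {}"
  using nonempty frontier_domain by force

text \<open>Along a curve in the loop through \<open>x\<close> the functional has a maximum at
  parameter 0, so its derivative vanishes there. It serves both for supporting lines and for
  maximizers of the action.\<close>

lemma critical_tangent:
  assumes "\<And>z. z \<in> \<gamma> \<Longrightarrow> \<nu> \<bullet> z \<le> \<nu> \<bullet> x" "v \<in> tangent_line \<gamma> x"
  shows "\<nu> \<bullet> v = 0"
proof -
  obtain c where c: "smooth_curve c" "range c \<subseteq> \<gamma>" "c 0 = x" "v = vector_derivative c (at 0)"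
    using assms(2) unfolding tangent_line_def by blast
  have "((\<lambda>t. \<nu> \<bullet> c t) has_vector_derivative \<nu> \<bullet> v) (at 0)"
    using bounded_linear.has_vector_derivative[OF bounded_linear_inner_right
      smooth_curve_has_vector_derivative[OF c(1)]] c(4) by blast
  then have "DERIV (\<lambda>t. \<nu> \<bullet> c t) 0 :> \<nu> \<bullet> v"
    by (simp add: has_real_derivative_iff_has_vector_derivative)
  then show ?thesis
    by (rule DERIV_local_max[where d = 1]) (use c assms(1) in auto)
qed

text \<open>The change of parameter \<open>s \<mapsto> t + a * s\<close> moves the point to
  parameter 0 and scales its velocity by \<open>a\<close>. Hence the set of velocities contains a
  whole line.\<close>

lemma scaled_velocity_in_tangent_line:
  assumes "smooth_curve c" "range c \<subseteq> \<gamma>"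
  shows "a *\<^sub>R vector_derivative c (at t) \<in> tangent_line \<gamma> (c t)"
proof -
  let ?d = "\<lambda>s. c (t + a * s)"
  have "vector_derivative ?d (at 0) = a *\<^sub>R vector_derivative c (at t)"
    using fun_cong[OF iterated_derivative_affine[OF assms(1), of 1 t a], of 0] by simp
  then show ?thesis
    using smooth_curve_affine[OF assms(1), of t a] assms(2)
    unfolding tangent_line_def by (intro CollectI exI[of _ ?d]) auto
qed

text \<open>Convexity yields a weak supporting inequality at \<open>x\<close>. It is strict because
  the midpoint of \<open>x\<close> and \<open>z\<close> lies in the open domain, where the
  functional stays strictly below its bound.\<close>

lemma supporting:
  assumes "x \<in> \<gamma>"
  shows "\<exists>\<nu>. \<nu> \<noteq> 0 \<and> (\<forall>z\<in>closure (inside \<gamma>). z \<noteq> x \<longrightarrow> \<nu> \<bullet> z < \<nu> \<bullet> x)"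
proof -
  let ?D = "inside \<gamma>"
  have "x \<in> closure ?D" "x \<notin> rel_interior ?D"
    using assms frontier_domain open_domain
    by (auto simp: frontier_def rel_interior_open interior_open)
  then obtain a where a: "a \<noteq> 0" "\<And>y. y \<in> closure ?D \<Longrightarrow> a \<bullet> x \<le> a \<bullet> y"
    using supporting_hyperplane_rel_boundary[OF convex_closure[OF convex_domain], of x]
      convex_rel_interior_closure[OF convex_domain] by (metis closure_closure)
  have "(-a) \<bullet> z < (-a) \<bullet> x" if z: "z \<in> closure ?D" "z \<noteq> x" for z
  proof -
    have "midpoint z x \<in> open_segment z x"
      using z by simp
    then have m: "midpoint z x \<in> ?D"
      using strictly_convex_domain z \<open>x \<in> closure ?D\<close> open_domain unfolding strictly_convex_def
      by (metis interior_open subsetD)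
    have "(-a) \<bullet> midpoint z x < (-a) \<bullet> x"
      by (rule inner_less_if_open[OF open_domain m]) (use a closure_subset in auto)
    then show ?thesis
      by (simp add: midpoint_def inner_add_right)
  qed
  then show ?thesis
    using a(1) by (intro exI[of _ "-a"]) simp
qed

text \<open>Rescaled velocities of the parametrization fill a line. Conversely every velocity is
  orthogonal to a supporting normal, and in the plane this leaves only that line.\<close>

lemma tangent_line_eq:
  assumes "x \<in> \<gamma>"
  obtains e where "e \<noteq> 0" "tangent_line \<gamma> x = range (\<lambda>s. s *\<^sub>R e)"
proof -
  obtain c where c: "smooth_curve c" "\<And>t. vector_derivative c (at t) \<noteq> 0" "range c = \<gamma>"
    using parametrization by blast
  obtain t where t: "x = c t" using assms c by blast
  let ?e = "vector_derivative c (at t)"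
  have sub: "range (\<lambda>s. s *\<^sub>R ?e) \<subseteq> tangent_line \<gamma> x"
    using scaled_velocity_in_tangent_line c t by blast
  then have e: "?e \<in> tangent_line \<gamma> x"
    using scaled_velocity_in_tangent_line[of c 1 t] c t by simp
  obtain \<nu> where \<nu>: "\<nu> \<noteq> 0" "\<And>z. z \<in> closure (inside \<gamma>) \<Longrightarrow> z \<noteq> x \<Longrightarrow> \<nu> \<bullet> z < \<nu> \<bullet> x"
    using supporting[OF assms] by blast
  have le: "\<nu> \<bullet> z \<le> \<nu> \<bullet> x" if "z \<in> \<gamma>" for z
    using \<nu>(2)[of z] that closure_domain by (cases "z = x") auto
  have "v \<in> range (\<lambda>s. s *\<^sub>R ?e)" if "v \<in> tangent_line \<gamma> x" for v
    using parallel_if_common_normal[of \<nu> v ?e] critical_tangent[OF le] that e \<nu>(1) c(2) by blast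
  with sub c(2) that show ?thesis by blast
qed

text \<open>Tangent vectors are orthogonal to a supporting normal, while strict support gives every
  chord from \<open>x\<close> a negative product with it.\<close>

lemma chord_not_tangent:
  assumes "x \<in> \<gamma>" "z \<in> \<gamma>" "z \<noteq> x"
  shows "z - x \<notin> tangent_line \<gamma> x"
proof
  assume T: "z - x \<in> tangent_line \<gamma> x"
  obtain \<nu> where \<nu>: "\<nu> \<noteq> 0" "\<And>z. z \<in> closure (inside \<gamma>) \<Longrightarrow> z \<noteq> x \<Longrightarrow> \<nu> \<bullet> z < \<nu> \<bullet> x"
    using supporting[OF assms(1)] by blast
  have "\<nu> \<bullet> z \<le> \<nu> \<bullet> x" if "z \<in> \<gamma>" for z
    using \<nu>(2)[of z] that closure_domain by (cases "z = x") auto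
  from critical_tangent[OF this T] \<nu>(2)[of z] assms closure_domain
  show False by (auto simp: inner_diff_right)
qed

text \<open>On a loop contained in a line the functional \<open>perp e\<close> would be constant, so
  the tangent at \<open>x\<close> would be that line and a chord from \<open>x\<close> would be
  tangent. This is what rules out degenerate maximizers.\<close>

lemma not_on_line:
  assumes "e \<noteq> 0" "x \<in> \<gamma>"
  shows "\<exists>z\<in>\<gamma>. z - x \<notin> range (\<lambda>s. s *\<^sub>R e)"
proof (rule ccontr)
  assume "\<not> ?thesis"
  then have "\<exists>s. z - x = s *\<^sub>R e" if "z \<in> \<gamma>" for z
    using that by blast
  moreover have "perp e \<bullet> (s *\<^sub>R e) = 0" for s
    by (subst inner_commute) (simp add: inner_perp)
  ultimately have on: "perp e \<bullet> (z - x) = 0" if "z \<in> \<gamma>" for z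
    using that by metis
  obtain f where f: "f \<noteq> 0" "tangent_line \<gamma> x = range (\<lambda>s. s *\<^sub>R f)"
    using tangent_line_eq[OF assms(2)] .
  have "perp e \<bullet> f = 0"
    by (rule critical_tangent[of _ x]) (use on f in \<open>auto simp: inner_diff_right intro: range_eqI[of _ _ 1]\<close>)
  obtain z where z: "z \<in> \<gamma>" "z \<noteq> x" using ex_other_point by blast
  have "perp e \<noteq> 0"
    using assms(1) unfolding perp_def vec2_nonzero by auto
  then have "\<exists>s. z - x = s *\<^sub>R f"
    using parallel_if_common_normal[of "perp e" "z - x" f] on[OF z(1)] \<open>perp e \<bullet> f = 0\<close> f(1)
    by simp
  then show False
    using chord_not_tangent[OF assms(2) z] f(2) by blast
qed

text \<open>Otherwise some functional separates the line from the domain. Being bounded below on the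
  line, it is constant along \<open>v\<close>; being maximal on the loop at \<open>x\<close>, it is
  also normal to the tangent. So \<open>v\<close> would be tangent.\<close>

lemma transversal_line_meets_inside:
  assumes "x \<in> \<gamma>" "v \<notin> tangent_line \<gamma> x"
  shows "\<exists>s. x + s *\<^sub>R v \<in> inside \<gamma>"
proof (rule ccontr)
  let ?L = "range (\<lambda>s. x + s *\<^sub>R v)"
  assume "\<not> ?thesis"
  then have "inside \<gamma> \<inter> ?L = {}" by blast
  moreover have "convex ?L"
  proof -
    have "convex ((\<lambda>y. x + y) ` (\<lambda>s. s *\<^sub>R v) ` UNIV)"
      by (intro convex_translation convex_linear_image) (auto intro: linearI simp: scaleR_left_distrib)
    then show ?thesis by (simp add: image_image)
  qed
  ultimately obtain a b where ab: "a \<noteq> 0" "\<forall>y\<in>inside \<gamma>. a \<bullet> y \<le> b" "\<forall>y\<in>?L. a \<bullet> y \<ge> b"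
    using separating_hyperplane_sets[OF convex_domain, of ?L] inside_nonempty by auto
  have xb: "a \<bullet> x \<ge> b"
    using ab(3) by (metis add.right_neutral rangeI scaleR_zero_left)
  have av: "a \<bullet> v = 0"
  proof (rule ccontr)
    assume n: "a \<bullet> v \<noteq> 0"
    \<comment> \<open>The parameter is chosen so that the functional takes the value
      \<open>b - 1\<close> there.\<close>
    have "a \<bullet> (x + ((b - 1 - a \<bullet> x) / (a \<bullet> v)) *\<^sub>R v) \<ge> b"
      using ab(3) by blast
    then show False using n by (simp add: inner_add_right)
  qed
  have cl: "a \<bullet> y \<le> b" if "y \<in> closure (inside \<gamma>)" for y
  proof -
    have "closure (inside \<gamma>) \<subseteq> {y. a \<bullet> y \<le> b}"
      by (rule closure_minimal) (use ab in \<open>auto simp: closed_halfspace_le\<close>)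
    then show ?thesis using that by blast
  qed
  obtain e where e: "e \<noteq> 0" "tangent_line \<gamma> x = range (\<lambda>s. s *\<^sub>R e)"
    using tangent_line_eq[OF assms(1)] .
  have "a \<bullet> e = 0"
  proof (rule critical_tangent[of _ x])
    show "a \<bullet> z \<le> a \<bullet> x" if "z \<in> \<gamma>" for z
      using cl[of z] xb that closure_domain by auto
    show "e \<in> tangent_line \<gamma> x"
      using e(2) by (auto intro: range_eqI[of _ _ 1])
  qed
  then show False
    using parallel_if_common_normal[OF av _ ab(1) e(1)] e(2) assms(2) by blast
qed

text \<open>The definite description is resolved by the normalized supporting normal
  \<open>n\<close>. Only \<open>n\<close> and \<open>-n\<close> are unit normals; the line through
  \<open>x\<close> along \<open>n\<close> enters the domain, and by support it does so on the
  negative side, which excludes \<open>-n\<close>.\<close>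

lemma outer_normal:
  assumes "x \<in> \<gamma>"
  shows "norm (outer_normal \<gamma> x) = 1" and "tangent_line \<gamma> x = {v. outer_normal \<gamma> x \<bullet> v = 0}"
proof -
  obtain \<nu> where \<nu>: "\<nu> \<noteq> 0" "\<And>z. z \<in> closure (inside \<gamma>) \<Longrightarrow> z \<noteq> x \<Longrightarrow> \<nu> \<bullet> z < \<nu> \<bullet> x"
    using supporting[OF assms] by blast
  have le: "\<nu> \<bullet> z \<le> \<nu> \<bullet> x" if "z \<in> \<gamma>" for z
    using \<nu>(2)[of z] that closure_domain by (cases "z = x") auto
  have xD: "x \<notin> inside \<gamma>"
    using assms inside_no_overlap by blast
  define n where "n = (1 / norm \<nu>) *\<^sub>R \<nu>"
  have n1: "norm n = 1" using \<nu>(1) by (simp add: n_def)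
  then have "n \<noteq> 0" by auto
  obtain e where e: "e \<noteq> 0" "tangent_line \<gamma> x = range (\<lambda>s. s *\<^sub>R e)"
    using tangent_line_eq[OF assms] .
  have ne: "n \<bullet> v = 0" if "v \<in> tangent_line \<gamma> x" for v
    using critical_tangent[OF le that] by (simp add: n_def)
  have eT: "e \<in> tangent_line \<gamma> x"
    using e(2) by (auto intro: range_eqI[of _ _ 1])
  have "n \<notin> tangent_line \<gamma> x"
    using ne[of n] n1 by auto
  then obtain s where s: "x + s *\<^sub>R n \<in> inside \<gamma>"
    using transversal_line_meets_inside[OF assms] by blast
  have out: "x + t *\<^sub>R n \<notin> inside \<gamma>" if "t \<ge> 0" for t
  proof
    assume I: "x + t *\<^sub>R n \<in> inside \<gamma>"
    then have "x + t *\<^sub>R n \<noteq> x" using xD by metis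
    then have "\<nu> \<bullet> (x + t *\<^sub>R n) < \<nu> \<bullet> x"
      using \<nu>(2) I closure_subset by blast
    moreover have "t * (\<nu> \<bullet> \<nu>) / norm \<nu> \<ge> 0"
      using that by simp
    ultimately show False
      by (simp add: inner_add_right n_def)
  qed
  with s have "s < 0" by (meson not_less)
  have inw: "x + t *\<^sub>R (-n) \<in> inside \<gamma>" if t: "0 < t" "t < -s" for t
  proof -
    have "x \<in> closure (inside \<gamma>)" using assms closure_domain by blast
    \<comment> \<open>The point divides the segment from \<open>x\<close> to the inside point
      \<open>x + s *\<^sub>R n\<close> in the ratio given by \<open>t / -s\<close>, which lies
      strictly between 0 and 1.\<close>
    then have "x + t *\<^sub>R (-n) \<in> interior (inside \<gamma>)"
      using mem_interior_closure_convex_shrink[OF convex_domain, of "x + s *\<^sub>R n" x "t / -s"]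
        s t \<open>s < 0\<close> open_domain by (simp add: interior_open divide_simps algebra_simps)
    then show ?thesis using open_domain by (simp add: interior_open)
  qed
  have "outer_normal \<gamma> x = n"
    unfolding outer_normal_def
  proof (rule the_equality)
    show "norm n = 1 \<and> (\<forall>v\<in>tangent_line \<gamma> x. n \<bullet> v = 0) \<and>
             (\<exists>\<epsilon>>0. \<forall>t. 0 < t \<and> t < \<epsilon> \<longrightarrow> x + t *\<^sub>R n \<notin> inside \<gamma>)"
      using n1 ne out by (auto intro!: exI[of _ 1])
  next
    fix m assume m: "norm m = 1 \<and> (\<forall>v\<in>tangent_line \<gamma> x. m \<bullet> v = 0) \<and>
             (\<exists>\<epsilon>>0. \<forall>t. 0 < t \<and> t < \<epsilon> \<longrightarrow> x + t *\<^sub>R m \<notin> inside \<gamma>)"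
    then obtain \<epsilon> where \<epsilon>: "\<epsilon> > 0" "\<And>t. 0 < t \<and> t < \<epsilon> \<Longrightarrow> x + t *\<^sub>R m \<notin> inside \<gamma>" by blast
    obtain r where r: "m = r *\<^sub>R n"
      using parallel_if_common_normal[of e m n] m eT ne[OF eT] e(1) \<open>n \<noteq> 0\<close>
      unfolding inner_commute[of e] by blast
    then have "\<bar>r\<bar> = 1" using m n1 by simp
    moreover have "r \<noteq> -1"
    proof
      assume "r = -1"
      then have m: "m = -n" using r by simp
      obtain t where "0 < t" "t < min \<epsilon> (-s)"
        using \<open>\<epsilon> > 0\<close> \<open>s < 0\<close> dense[of 0 "min \<epsilon> (-s)"] by auto
      then show False
        using \<epsilon>(2)[of t] inw[of t] unfolding m by simp
    qed
    ultimately show "m = n" using r by (auto simp: abs_if split: if_splits)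
  qed
  moreover have "v \<in> tangent_line \<gamma> x" if "n \<bullet> v = 0" for v
    using parallel_if_common_normal[OF that ne[OF eT] \<open>n \<noteq> 0\<close> e(1)] e(2) by blast
  ultimately show "norm (outer_normal \<gamma> x) = 1"
    and "tangent_line \<gamma> x = {v. outer_normal \<gamma> x \<bullet> v = 0}"
    using n1 ne by auto
qed

lemma not_between:
  assumes "a \<in> \<gamma>" "b \<in> \<gamma>" "x \<in> \<gamma>" "between (a, b) x"
  shows "x = a \<or> x = b"
proof (rule ccontr)
  assume n: "\<not> ?thesis"
  then have "x \<in> open_segment a b"
    using assms(4) by (auto simp: between_mem_segment open_segment_def)
  moreover from this have "a \<noteq> b" by auto
  moreover have "a \<in> closure (inside \<gamma>)" "b \<in> closure (inside \<gamma>)"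
    using assms(1,2) closure_domain by auto
  ultimately have "x \<in> interior (inside \<gamma>)"
    using strictly_convex_domain unfolding strictly_convex_def by blast
  then show False
    using assms(3) inside_no_overlap[of \<gamma>] interior_subset by blast
qed

text \<open>Of three distinct collinear points one lies between the other two, which strict
  convexity forbids on the loop.\<close>

lemma line_meets_at_most_twice:
  assumes "a \<in> \<gamma>" "b \<in> \<gamma>" "x \<in> \<gamma>" "a \<noteq> x" "b \<noteq> x"
    and "a - x = s *\<^sub>R e" "b - x = t *\<^sub>R e"
  shows "a = b"
proof -
  have "collinear {x, a, b}"
    unfolding collinear_def
  proof (intro exI[of _ e] ballI)
    fix p q assume "p \<in> {x, a, b}" "q \<in> {x, a, b}"
    then have "\<exists>c. p - x = c *\<^sub>R e" "\<exists>c. q - x = c *\<^sub>R e"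
      using assms(6,7) by (auto intro: exI[of _ 0])
    then obtain c d where "p - x = c *\<^sub>R e" "q - x = d *\<^sub>R e" by blast
    then have "p - q = (c - d) *\<^sub>R e"
      by (simp add: algebra_simps)
    then show "\<exists>c. p - q = c *\<^sub>R e" by blast
  qed
  then show ?thesis
    using assms(1-5) not_between unfolding collinear_between_cases by metis
qed

end


section \<open>Well-definedness and injectivity of the billiard map\<close>

lemma transversal_iff:
  assumes "convex_loop \<gamma>" "convex_loop \<delta>" "x0 \<in> \<gamma>" "x1 \<in> \<delta>"
    and "e \<in> tangent_line \<delta> x1" "e \<noteq> 0"
  shows "transversal \<gamma> \<delta> x0 x1 \<longleftrightarrow> e \<notin> tangent_line \<gamma> x0"
proof -
  interpret g: convex_loop \<gamma> by fact
  interpret d: convex_loop \<delta> by fact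
  \<comment> \<open>As \<open>e\<close> is orthogonal to the second normal, the two normals are
    dependent exactly when \<open>e\<close> is orthogonal to the first one too.\<close>
  have "outer_normal \<delta> x1 \<noteq> 0" "outer_normal \<delta> x1 \<bullet> e = 0"
    using d.outer_normal[OF assms(4)] assms(5) by auto
  then show ?thesis
    unfolding transversal_def g.outer_normal(2)[OF assms(3)]
    using det_vector_eq_0_iff[OF assms(6)] by simp
qed

lemma next_point_eqI:
  assumes "convex_loop \<gamma>" "convex_loop \<delta>" "x0 \<in> \<gamma>" "x1 \<in> \<delta>"
    and "x2 \<in> \<gamma>" "x2 \<noteq> x0" "x2 - x0 \<in> tangent_line \<delta> x1"
  shows "next_point \<gamma> \<delta> x0 x1 = x2"
  unfolding next_point_def
proof (rule the_equality)
  show "x2 \<in> \<gamma> \<and> x2 \<in> (\<lambda>v. x0 + v) ` tangent_line \<delta> x1 \<and> x2 \<noteq> x0"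
    using assms(5-7) by (auto intro: image_eqI[of _ _ "x2 - x0"])
next
  interpret g: convex_loop \<gamma> by fact
  interpret d: convex_loop \<delta> by fact
  fix y assume y: "y \<in> \<gamma> \<and> y \<in> (\<lambda>v. x0 + v) ` tangent_line \<delta> x1 \<and> y \<noteq> x0"
  obtain e where e: "tangent_line \<delta> x1 = range (\<lambda>s. s *\<^sub>R e)"
    using d.tangent_line_eq[OF assms(4)] by blast
  obtain s t where "y - x0 = s *\<^sub>R e" "x2 - x0 = t *\<^sub>R e"
    using y assms(7) unfolding e by auto
  then show "y = x2"
    using g.line_meets_at_most_twice[of y x2 x0] y assms by blast
qed

text \<open>Transversality makes the line through \<open>x0\<close> enter the domain; continued
  beyond an inside point, it must leave the bounded domain at a second point of the loop.\<close>

lemma next_point_spec: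
  assumes "convex_loop \<gamma>" "convex_loop \<delta>" "x0 \<in> \<gamma>" "x1 \<in> \<delta>" "transversal \<gamma> \<delta> x0 x1"
  shows "next_point \<gamma> \<delta> x0 x1 \<in> \<gamma>" "next_point \<gamma> \<delta> x0 x1 \<noteq> x0"
    "next_point \<gamma> \<delta> x0 x1 - x0 \<in> tangent_line \<delta> x1"
proof -
  interpret g: convex_loop \<gamma> by fact
  interpret d: convex_loop \<delta> by fact
  obtain e where e: "e \<noteq> 0" "tangent_line \<delta> x1 = range (\<lambda>s. s *\<^sub>R e)"
    using d.tangent_line_eq[OF assms(4)] by blast
  have "e \<notin> tangent_line \<gamma> x0"
    using transversal_iff[OF assms(1-4), of e] assms(5) e by (metis rangeI scaleR_one)
  then obtain s where s: "x0 + s *\<^sub>R e \<in> inside \<gamma>"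
    using g.transversal_line_meets_inside[OF assms(3)] by blast
  have "s \<noteq> 0"
  proof
    assume "s = 0"
    then have "x0 \<in> inside \<gamma>" using s by simp
    with assms(3) show False using inside_no_overlap[of \<gamma>] by blast
  qed
  \<comment> \<open>The ray runs in the direction \<open>s *\<^sub>R e\<close>, away from
    \<open>x0\<close>, so the exit point has the nonzero parameter
    \<open>s * (1 + r)\<close>.\<close>
  obtain r where r: "r > 0" "(x0 + s *\<^sub>R e) + r *\<^sub>R (s *\<^sub>R e) \<in> \<gamma>"
  proof (rule ray_to_frontier[OF g.bounded_domain])
    show "x0 + s *\<^sub>R e \<in> interior (inside \<gamma>)"
      using s g.open_domain by (simp add: interior_open)
    show "s *\<^sub>R e \<noteq> 0"
      using \<open>s \<noteq> 0\<close> e(1) by simp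
  qed (use g.frontier_domain in simp)
  define y where "y = x0 + (s * (1 + r)) *\<^sub>R e"
  have "y \<in> \<gamma>"
    using r(2) by (simp add: y_def algebra_simps)
  moreover have "y \<noteq> x0" "y - x0 \<in> tangent_line \<delta> x1"
    using r(1) \<open>s \<noteq> 0\<close> e by (simp_all add: y_def)
  ultimately show "next_point \<gamma> \<delta> x0 x1 \<in> \<gamma>" "next_point \<gamma> \<delta> x0 x1 \<noteq> x0"
    "next_point \<gamma> \<delta> x0 x1 - x0 \<in> tangent_line \<delta> x1"
    using next_point_eqI[OF assms(1-4)] by auto
qed

text \<open>Seen from the new point, the old one is the other intersection of the loop with the same
  line, and there is at most one such.\<close>

lemma next_point_inject:
  assumes "convex_loop \<gamma>" "convex_loop \<delta>" "x0 \<in> \<gamma>" "x0' \<in> \<gamma>" "x1 \<in> \<delta>"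
    and "transversal \<gamma> \<delta> x0 x1" "transversal \<gamma> \<delta> x0' x1"
    and "next_point \<gamma> \<delta> x0 x1 = next_point \<gamma> \<delta> x0' x1"
  shows "x0 = x0'"
proof -
  interpret g: convex_loop \<gamma> by fact
  interpret d: convex_loop \<delta> by fact
  obtain e where e: "tangent_line \<delta> x1 = range (\<lambda>s. s *\<^sub>R e)"
    using d.tangent_line_eq[OF assms(5)] by blast
  let ?y = "next_point \<gamma> \<delta> x0 x1"
  note spec = next_point_spec[OF assms(1,2,3,5,6)] next_point_spec[OF assms(1,2,4,5,7)]
  obtain s t where "?y - x0 = s *\<^sub>R e" "?y - x0' = t *\<^sub>R e"
    using spec(3,6) assms(8) unfolding e by auto
  then have "x0 - ?y = (-s) *\<^sub>R e" "x0' - ?y = (-t) *\<^sub>R e"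
    by (metis minus_diff_eq scaleR_minus_left)+
  then show ?thesis
    using g.line_meets_at_most_twice[of x0 x0' ?y] spec assms by metis
qed

text \<open>Negative iterates are defined through \<open>inv_into\<close>; injectivity makes this a
  genuine left inverse on the phase space.\<close>

lemma inj_on_symplectic_billiard:
  assumes "convex_loop \<gamma>" "convex_loop \<delta>"
  shows "inj_on (symplectic_billiard \<gamma> \<delta>) (phase_space \<gamma> \<delta>)"
proof (rule inj_onI)
  fix p q assume "p \<in> phase_space \<gamma> \<delta>" "q \<in> phase_space \<gamma> \<delta>"
    and "symplectic_billiard \<gamma> \<delta> p = symplectic_billiard \<gamma> \<delta> q"
  then show "p = q"
    using next_point_inject[OF assms] next_point_inject[OF assms(2,1)]
    by (auto simp: phase_space_def symplectic_billiard_def split: sum.splits)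
qed

section \<open>The action on closed configurations and its maximizers\<close>

definition alternate :: "(real^2) set \<Rightarrow> (real^2) set \<Rightarrow> nat \<Rightarrow> (real^2) set" where
  "alternate \<gamma> \<delta> k = (if even k then \<gamma> else \<delta>)"

definition action :: "nat \<Rightarrow> (nat \<Rightarrow> real^2) \<Rightarrow> real" where
  "action N z = (\<Sum>i<N. z i \<bullet> perp (z (Suc i mod N)))"

definition maximizer :: "(real^2) set \<Rightarrow> (real^2) set \<Rightarrow> nat \<Rightarrow> (nat \<Rightarrow> real^2) \<Rightarrow> bool" where
  "maximizer \<gamma> \<delta> N z \<longleftrightarrow> z \<in> Pi UNIV (alternate \<gamma> \<delta>) \<and>
     (\<forall>z'\<in>Pi UNIV (alternate \<gamma> \<delta>). action N z' \<le> action N z)"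

lemma convex_loop_alternate:
  "convex_loop \<gamma> \<Longrightarrow> convex_loop \<delta> \<Longrightarrow> convex_loop (alternate \<gamma> \<delta> k)"
  by (simp add: alternate_def)

text \<open>Configurations are infinite sequences, so they form a full product of compact loops,
  compact by Tychonoff. The action is a polynomial in finitely many coordinates, hence
  continuous.\<close>

lemma ex_maximizer:
  assumes "convex_loop \<gamma>" "convex_loop \<delta>"
  shows "\<exists>z. maximizer \<gamma> \<delta> N z"
proof -
  let ?K = "Pi UNIV (alternate \<gamma> \<delta>)"
  have c: "compact (alternate \<gamma> \<delta> k)" "alternate \<gamma> \<delta> k \<noteq> {}" for k
    using convex_loop.compact_loop convex_loop.nonempty convex_loop_alternate[OF assms] by blast+
  have "compactin (product_topology (\<lambda>i. euclidean) UNIV) (PiE UNIV (alternate \<gamma> \<delta>))"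
    using c by (subst compactin_PiE) auto
  then have "compact ?K"
    by (simp add: PiE_UNIV_domain euclidean_product_topology)
  moreover have "?K \<noteq> {}"
    using c(2) by (simp add: Pi_eq_empty)
  moreover have "continuous_on ?K (action N)"
    unfolding action_def inner_perp
    by (intro continuous_intros continuous_on_component
      continuous_on_subset[OF continuous_on_product_coordinates subset_UNIV])
  ultimately show ?thesis
    using continuous_attains_sup[of ?K "action N"] unfolding maximizer_def by blast
qed

text \<open>Only the terms of the edges from \<open>i\<close> to \<open>j\<close> and from
  \<open>j\<close> to \<open>l\<close> contain the vertex \<open>j\<close>. By antisymmetry of the
  determinant they combine into one linear functional of that vertex, given by the chord between its
  neighbours.\<close>

lemma action_update:
  assumes "i < N" "3 \<le> N" "Suc i mod N = j" "Suc j mod N = l"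
  shows "action N (z(j := v)) - action N z = (v - z j) \<bullet> perp (z l - z i)"
proof -
  have j: "j < N" "i \<noteq> j" "l \<noteq> j"
    using assms by (auto simp: mod_Suc split: if_splits)
  let ?z = "z(j := v)"
  let ?R = "{..<N} - {i} - {j}"
  have split: "action N w = w i \<bullet> perp (w j) + (w j \<bullet> perp (w l)
      + (\<Sum>r\<in>?R. w r \<bullet> perp (w (Suc r mod N))))" for w
    unfolding action_def using j assms
    by (subst sum.remove[of _ i], simp, simp, subst sum.remove[of _ j]) auto
  have "Suc r mod N \<noteq> j" if "r \<in> ?R" for r
    using that assms by (auto simp: mod_Suc split: if_splits)
  then have "(\<Sum>r\<in>?R. ?z r \<bullet> perp (?z (Suc r mod N))) = (\<Sum>r\<in>?R. z r \<bullet> perp (z (Suc r mod N)))"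
    by (intro sum.cong) auto
  then show ?thesis
    using j unfolding split[of ?z] split[of z] by (simp add: inner_perp algebra_simps)
qed

context
  fixes \<gamma> \<delta> :: "(real^2) set" and N :: nat
  assumes loops: "convex_loop \<gamma>" "convex_loop \<delta>" and N: "even N" "3 \<le> N"
begin

text \<open>Evenness of \<open>N\<close> keeps the alternation of the loops consistent when the
  indices wrap around.\<close>

lemma alternate_mod [simp]: "alternate \<gamma> \<delta> (k mod N) = alternate \<gamma> \<delta> k"
  using N(1) by (simp add: alternate_def dvd_mod_iff)

lemma maximizer_mem: "maximizer \<gamma> \<delta> N z \<Longrightarrow> z (k mod N) \<in> alternate \<gamma> \<delta> k"
  unfolding maximizer_def by (metis PiE UNIV_I alternate_mod)

lemma action_update_mod:
  "action N (z(Suc k mod N := v)) - action N z =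
     (v - z (Suc k mod N)) \<bullet> perp (z (Suc (Suc k) mod N) - z (k mod N))"
  by (rule action_update) (use N in \<open>auto simp: mod_Suc_eq\<close>)

lemma update_mem:
  assumes "maximizer \<gamma> \<delta> N z" "v \<in> alternate \<gamma> \<delta> k"
  shows "z(k mod N := v) \<in> Pi UNIV (alternate \<gamma> \<delta>)"
  using assms unfolding maximizer_def by auto

text \<open>Moving one vertex alone, the action is a linear functional with normal
  \<open>perp\<close> of the chord, maximal at the present vertex. So the tangent there is
  orthogonal to this normal, that is, parallel to the chord. The chord may still be zero.\<close>

lemma maximizer_chord:
  assumes "maximizer \<gamma> \<delta> N z"
  shows "z (Suc (Suc k) mod N) - z (k mod N) \<in> tangent_line (alternate \<gamma> \<delta> (Suc k)) (z (Suc k mod N))"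
    (is "?w \<in> tangent_line ?G ?x")
proof -
  interpret G: convex_loop ?G using convex_loop_alternate[OF loops] .
  have x: "?x \<in> ?G" using maximizer_mem[OF assms] .
  obtain e where e: "e \<noteq> 0" "tangent_line ?G ?x = range (\<lambda>s. s *\<^sub>R e)"
    using G.tangent_line_eq[OF x] .
  have "perp ?w \<bullet> e = 0"
  proof (rule G.critical_tangent)
    show "perp ?w \<bullet> v \<le> perp ?w \<bullet> ?x" if "v \<in> ?G" for v
      using action_update_mod[of z k v] assms update_mem[OF assms that]
      unfolding maximizer_def by (force simp: inner_diff_left inner_commute[of "perp _"])
    show "e \<in> tangent_line ?G ?x"
      using e(2) by (auto intro: range_eqI[of _ _ 1])
  qed
  then have "?w \<bullet> perp e = 0"
    by (simp add: inner_perp inner_commute[of "perp _"] mult.commute)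
  then show ?thesis
    using parallel_if_perp_eq_0 e by blast
qed

lemma maximizer_distinct:
  assumes "maximizer \<gamma> \<delta> N z"
  shows "z (Suc (Suc k) mod N) \<noteq> z (k mod N)"
proof
  assume eq: "z (Suc (Suc k) mod N) = z (k mod N)"
  let ?a = "Suc k mod N" and ?b = "Suc (Suc k) mod N" and ?c = "Suc (Suc (Suc k)) mod N"
  let ?G = "alternate \<gamma> \<delta> (Suc k)" and ?H = "alternate \<gamma> \<delta> (Suc (Suc k))"
  interpret G: convex_loop ?G using convex_loop_alternate[OF loops] .
  interpret H: convex_loop ?H using convex_loop_alternate[OF loops] .
  \<comment> \<open>Replacing vertex \<open>k + 1\<close> must leave vertices \<open>k + 2\<close>
    and \<open>k + 3\<close> in place; the latter uses \<open>3 \<le> N\<close>.\<close>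
  have ne: "?b \<noteq> ?a" "?c \<noteq> ?a"
    using N by (auto simp: mod_Suc split: if_splits)
  have G': "alternate \<gamma> \<delta> (Suc (Suc (Suc k))) = ?G"
    by (simp add: alternate_def)
  obtain e where e: "e \<noteq> 0" "tangent_line ?H (z ?b) = range (\<lambda>s. s *\<^sub>R e)"
    using H.tangent_line_eq[OF maximizer_mem[OF assms]] .
  \<comment> \<open>With a zero chord every \<open>v\<close> on the loop gives another maximizer;
    its chord condition at vertex \<open>k + 2\<close> puts \<open>v\<close> on one fixed line
    through \<open>z ?c\<close>.\<close>
  have "v - z ?c \<in> range (\<lambda>s. s *\<^sub>R e)" if v: "v \<in> ?G" for v
  proof -
    have "action N (z(?a := v)) = action N z"
      using action_update_mod[of z k v] eq by (simp add: inner_perp)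
    then have "maximizer \<gamma> \<delta> N (z(?a := v))"
      using assms update_mem[OF assms v] unfolding maximizer_def by simp
    from maximizer_chord[OF this, of "Suc k"] have "z ?c - v \<in> range (\<lambda>s. s *\<^sub>R e)"
      using ne e(2) by simp
    then obtain s where "z ?c - v = s *\<^sub>R e" by blast
    then have "v - z ?c = (-s) *\<^sub>R e"
      by (metis minus_diff_eq scaleR_minus_left)
    then show ?thesis by blast
  qed
  then show False
    using G.not_on_line[OF e(1)] maximizer_mem[OF assms, of "Suc (Suc (Suc k))"] unfolding G' by blast
qed

lemma ex_closed_trajectory:
  obtains Z where "\<And>k. Z (k + N) = Z k" "\<And>k. Z k \<in> alternate \<gamma> \<delta> k" "\<And>k. Z (k + 2) \<noteq> Z k"
    "\<And>k. Z (k + 2) - Z k \<in> tangent_line (alternate \<gamma> \<delta> (k + 1)) (Z (k + 1))"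
proof -
  obtain z where z: "maximizer \<gamma> \<delta> N z"
    using ex_maximizer[OF loops] by blast
  show thesis
    by (rule that[of "\<lambda>k. z (k mod N)"])
      (use maximizer_mem[OF z] maximizer_chord[OF z] maximizer_distinct[OF z] in auto)
qed

end

section \<open>Periodic orbits with arbitrarily many points\<close>

lemma ex_periodic_orbit_of_large_card:
  assumes loops: "convex_loop \<gamma>" "convex_loop \<delta>" and p: "prime p"
  shows "\<exists>C\<in>periodic_orbits \<gamma> \<delta>. finite C \<and> p \<le> card C"
proof -
  let ?N = "2 * p" and ?f = "symplectic_billiard \<gamma> \<delta>" and ?A = "phase_space \<gamma> \<delta>"
  have "2 \<le> p" using p prime_ge_2_nat by blast
  obtain Z where Z: "\<And>k. Z (k + ?N) = Z k" "\<And>k. Z k \<in> alternate \<gamma> \<delta> k" "\<And>k. Z (k + 2) \<noteq> Z k"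
    "\<And>k. Z (k + 2) - Z k \<in> tangent_line (alternate \<gamma> \<delta> (k + 1)) (Z (k + 1))"
    using ex_closed_trajectory[OF loops, of ?N] \<open>2 \<le> p\<close> by auto
  define P :: "nat \<Rightarrow> phase_point" where
    "P k = (if even k then Inl (Z k, Z (k + 1)) else Inr (Z k, Z (k + 1)))" for k
  note G = convex_loop_alternate[OF loops]
  have Z2: "Z (k + 2) \<in> alternate \<gamma> \<delta> k" for k
    using Z(2)[of "k + 2"] by (simp add: alternate_def)
  \<comment> \<open>The nonzero chord from \<open>Z k\<close> to \<open>Z (k + 2)\<close> is tangent
    at \<open>Z (k + 1)\<close>, but, joining two points of one loop, it is not tangent at
    \<open>Z k\<close>.\<close>
  have tr: "transversal (alternate \<gamma> \<delta> k) (alternate \<gamma> \<delta> (k + 1)) (Z k) (Z (k + 1))" for k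
    using transversal_iff[OF G G Z(2) Z(2) Z(4)] convex_loop.chord_not_tangent[OF G Z(2) Z2 Z(3)]
      Z(3)[of k] by simp
  have A: "P k \<in> ?A" for k
    using Z(2)[of k] Z(2)[of "k + 1"] tr[of k]
    by (auto simp: P_def phase_space_def alternate_def split: if_splits)
  have next_Z: "next_point (alternate \<gamma> \<delta> k) (alternate \<gamma> \<delta> (k + 1)) (Z k) (Z (k + 1)) = Z (k + 2)" for k
    by (rule next_point_eqI[OF G G Z(2) Z(2) Z2 Z(3,4)])
  have f: "?f (P k) = P (k + 1)" for k
    using next_Z[of k] by (auto simp: P_def symplectic_billiard_def alternate_def split: if_splits)
  have PN: "P (k + ?N) = P k" for k
    using Z(1)[of k] Z(1)[of "k + 1"] by (simp add: P_def)
  have fn: "(?f ^^ n) (P k) = P (k + n)" for n k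
    by (induction n) (auto simp: f)
  \<comment> \<open>With natural indices the predecessor is reached by going \<open>?N - 1\<close>
    steps forward along the cycle.\<close>
  have inv1: "inv_into ?A ?f (P k) = P (k + (?N - 1))" for k
  proof -
    have "P k = ?f (P (k + (?N - 1)))"
      using f[of "k + (?N - 1)"] PN[of k] \<open>2 \<le> p\<close> by simp
    then show ?thesis
      using inv_into_f_f[OF inj_on_symplectic_billiard[OF loops] A] by metis
  qed
  have inv: "(inv_into ?A ?f ^^ n) (P 0) = P (n * (?N - 1))" for n
    by (induction n) (auto simp: inv1 add.commute)
  have P_mult: "P (k + n * ?N) = P k" for k n
    by (induction n) (use PN in \<open>auto simp: add.assoc[symmetric] add.commute[of "2 * p"]\<close>)
  let ?O = "billiard_orbit \<gamma> \<delta> (P 0)"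
  \<comment> \<open>Finiteness of the orbit is needed for the count, as \<open>card\<close> is 0 on
    infinite sets.\<close>
  have "?O \<subseteq> range P"
    unfolding billiard_orbit_def billiard_iterate_def using fn[of _ 0] inv by auto
  moreover have "range P \<subseteq> P ` {..<?N}"
  proof
    fix q assume "q \<in> range P"
    then obtain k where "q = P k" by blast
    then have "q = P (k mod ?N)"
      using P_mult[of "k mod ?N" "k div ?N"] by (metis mod_div_mult_eq)
    then show "q \<in> P ` {..<?N}" using \<open>2 \<le> p\<close> by auto
  qed
  ultimately have "finite ?O"
    by (meson finite_imageI finite_lessThan finite_subset)
  \<comment> \<open>A coincidence would make \<open>2 * d\<close> a period for some \<open>d\<close>
    between 0 and \<open>p\<close>. As \<open>d\<close> is coprime to \<open>p\<close>, Bezout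
    combines it with the period \<open>2 * p\<close> into the period 2, against
    \<open>Z 2 \<noteq> Z 0\<close>.\<close>
  have "inj_on (\<lambda>i. P (2 * i)) {..<p}"
  proof (rule linorder_inj_onI)
    fix i j assume ij: "i < j" "i \<in> {..<p}" "j \<in> {..<p}"
    show "P (2 * i) \<noteq> P (2 * j)"
    proof
      assume eq: "P (2 * i) = P (2 * j)"
      define d where "d = j - i"
      have d: "0 < d" "d < p" "j = i + d" using ij by (auto simp: d_def)
      have "P (k + 2 * d) = P k" for k
      proof -
        \<comment> \<open>Running both equal points forward by the same time carries the first to
          \<open>P (k + ?N)\<close>, which spreads the coincidence to all indices
          \<open>k\<close>.\<close>
        have "P (2 * i + (k + (?N - 2 * i))) = P (2 * j + (k + (?N - 2 * i)))"
          using eq by (metis fn)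
        moreover have "2 * i + (k + (?N - 2 * i)) = k + ?N"
          "2 * j + (k + (?N - 2 * i)) = k + 2 * d + ?N"
          using ij d by auto
        ultimately show ?thesis by (metis PN)
      qed
      then have Pd: "P (n * (2 * d)) = P 0" for n
        by (induction n) (auto simp: add.commute[of "2 * d"])
      have "gcd d p = 1"
        using p d by (metis coprime_commute coprime_iff_gcd_eq_1 nat_dvd_not_less prime_imp_coprime)
      then obtain x y where "d * x = p * y + 1"
        using bezout_nat[of d p] d by auto
      then have "x * (2 * d) = 2 + y * ?N" by (simp add: algebra_simps)
      then have "P 2 = P 0"
        using Pd[of x] P_mult[of 2 y] by simp
      then show False
        using Z(3)[of 0] by (simp add: P_def numeral_2_eq_2)
    qed
  qed auto
  then have "card ((\<lambda>i. P (2 * i)) ` {..<p}) = p"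
    by (simp add: card_image)
  moreover have "(\<lambda>i. P (2 * i)) ` {..<p} \<subseteq> ?O"
  proof
    fix q assume "q \<in> (\<lambda>i. P (2 * i)) ` {..<p}"
    then obtain i where "q = P (2 * i)" by blast
    then have "q = billiard_iterate \<gamma> \<delta> (int (2 * i)) (P 0)"
      unfolding billiard_iterate_def by (simp only: nat_int fn if_True of_nat_0_le_iff add_0)
    then show "q \<in> ?O"
      unfolding billiard_orbit_def by blast
  qed
  ultimately have "p \<le> card ?O"
    using card_mono[OF \<open>finite ?O\<close>] by metis
  moreover have "?O \<in> periodic_orbits \<gamma> \<delta>"
    unfolding periodic_orbits_def
    using A[of 0] fn[of ?N 0] PN[of 0] \<open>2 \<le> p\<close>
    by (intro CollectI exI[of _ "P 0"] conjI exI[of _ ?N]) auto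
  ultimately show ?thesis
    using \<open>finite ?O\<close> by blast
qed

theorem theorem1p5:
  fixes \<gamma>m \<gamma>p :: "(real^2) set"
  assumes "smooth_embedded_loop \<gamma>m" and "\<exists>D. bounds_domain \<gamma>m D \<and> strictly_convex D"
    and "smooth_embedded_loop \<gamma>p" and "\<exists>D. bounds_domain \<gamma>p D \<and> strictly_convex D"
  shows "infinite (periodic_orbits \<gamma>m \<gamma>p)"
proof
  assume fin: "finite (periodic_orbits \<gamma>m \<gamma>p)"
  have loops: "convex_loop \<gamma>m" "convex_loop \<gamma>p"
    using assms by (simp_all add: convex_loop_def)
  \<comment> \<open>The orbit supplied for this prime would have more points than any of the
    finitely many periodic orbits, itself included.\<close>
  obtain p :: nat where p: "prime p" "Max (card ` periodic_orbits \<gamma>m \<gamma>p) < p"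
    using bigger_prime by blast
  obtain C where "C \<in> periodic_orbits \<gamma>m \<gamma>p" "p \<le> card C"
    using ex_periodic_orbit_of_large_card[OF loops p(1)] by blast
  then have "card C \<le> Max (card ` periodic_orbits \<gamma>m \<gamma>p)"
    using fin by simp
  with p(2) \<open>p \<le> card C\<close> show False by simp
qed

end
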